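(* $\mathsf{s}_{\le 5}(C_3^3)=9$.
   Context: $C_3$ denotes the cyclic group of order $3$, written additively, and $C_3^3$ is the direct sum of three copies of $C_3$. For a finite abelian group $G$ (written additively), a sequence over $G$ is a finite unordered list of elements of $G$ with repetition allowed (a finite multiset); its length is its number of terms counted with multiplicity, and it is zero-sum if the sum of its terms (with multiplicity) is $0$. A subsequence is a sub-multiset. For a positive integer $t$, $\mathsf{s}_{\le t}(G)$ denotes the smallest integer $\ell$ (if it exists) such that every sequence over $G$ of length $\ell$ has a zero-sum subsequence $T$ of length $1\le |T|\le t$. *)

theory Defs
  imports Main "HOL-Library.Multiset" "HOL-Library.Extended_Nat"
    "HOL-Library.Numeral_Type" "HOL-Library.Product_Plus"
begin

definition zero_sum :: "'a::ab_group_add multiset \<Rightarrow> bool" where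
  "zero_sum S \<longleftrightarrow> sum_mset S = 0"

(* A finite abelian group is a type of class {finite, ab_group_add}; it enters as TYPE('a).
   The infimum is taken in enat: it is the least such l, and infinity if there is none. *)
definition s_le :: "'a::{finite,ab_group_add} itself \<Rightarrow> nat \<Rightarrow> enat" where
  "s_le G t = Inf (enat ` {l. \<forall>S :: 'a multiset. size S = l \<longrightarrow>
     (\<exists>T. T \<subseteq># S \<and> zero_sum T \<and> 1 \<le> size T \<and> size T \<le> t)})"

(* The numeral type 3 has exactly the elements 0, 1, 2, with addition modulo 3. *)
type_synonym C3 = 3

(* Addition on product types is componentwise (Product_Plus). *)
type_synonym C3_cubed = "C3 \<times> C3 \<times> C3"

end

theory Submission imports Defs begin

text \<open>
  Upper bound: the indicator function of \<open>0\<close> on \<open>C\<^sub>3\<^sup>3\<close> is the polynomial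
  \<open>(1 - x\<^sup>2) (1 - y\<^sup>2) (1 - z\<^sup>2)\<close> of degree \<open>6\<close> over the field with three elements, so its
  seventh differences vanish: in a sequence of length \<open>7\<close> the number of zero-sum subsequences of even
  length is congruent modulo \<open>3\<close> to the number of those of odd length.  If a sequence \<open>S\<close> of length
  \<open>9\<close> has no short zero-sum subsequence, only the lengths \<open>0\<close>, \<open>6\<close>, \<open>7\<close> contribute, and it follows
  that \<open>\<sigma>(S) - a - b\<close> is \<open>0\<close> or a term of multiplicity two, for any two terms \<open>a\<close>, \<open>b\<close> of \<open>S\<close>.
  Counting forces \<open>S\<close> to consist of four double terms and one simple term, and then every double
  term equals \<open>-\<sigma>(S)\<close>, which is absurd.

  Lower bound: take the points \<open>(x, y, 1)\<close> with \<open>x, y \<in> {0, 1}\<close>, twice each.  The last coordinate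
  makes every zero-sum length a multiple of \<open>3\<close>, and no three of the terms sum to \<open>0\<close>.
\<close>

section \<open>Functions of bounded degree\<close>

text \<open>Polynomial degree via iterated differences: it makes sense on any abelian group and asks
  for no representation by monomials.\<close>

fun degree_le :: "nat \<Rightarrow> ('a::ab_group_add \<Rightarrow> 'b::comm_ring_1) \<Rightarrow> bool" where
  "degree_le 0 f \<longleftrightarrow> (\<forall>g h. f (h + g) = f h)"
| "degree_le (Suc n) f \<longleftrightarrow> (\<forall>g. degree_le n (\<lambda>h. f (h + g) - f h))"

lemma degree_le_add:
  "degree_le n f \<Longrightarrow> degree_le n f' \<Longrightarrow> degree_le n (\<lambda>h. f h + f' h)"
proof (induction n arbitrary: f f')
  case (Suc n)
  show ?case
  proof (simp, intro allI)
    fix g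
    have "degree_le n (\<lambda>h. (f (h + g) - f h) + (f' (h + g) - f' h))"
      using Suc.prems by (intro Suc.IH) simp_all
    then show "degree_le n (\<lambda>h. f (h + g) + f' (h + g) - (f h + f' h))"
      by (simp add: algebra_simps)
  qed
qed simp

lemma degree_le_cmult:
  "degree_le n f \<Longrightarrow> degree_le n (\<lambda>h. c * f h)"
proof (induction n arbitrary: f)
  case (Suc n)
  show ?case
  proof (simp, intro allI)
    fix g
    have "degree_le n (\<lambda>h. c * (f (h + g) - f h))"
      using Suc.prems by (intro Suc.IH) simp
    then show "degree_le n (\<lambda>h. c * f (h + g) - c * f h)"
      by (simp add: algebra_simps)
  qed
qed simp

lemma degree_le_Suc: "degree_le n f \<Longrightarrow> degree_le (Suc n) f"
proof (induction n arbitrary: f)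
  case (Suc n)
  show ?case
    by (subst degree_le.simps, intro allI Suc.IH) (use Suc.prems in simp)
qed simp

lemma degree_le_const: "degree_le n (\<lambda>h. c)"
  by (induction n arbitrary: c) simp_all

lemma degree_le_0D: "degree_le 0 f \<Longrightarrow> f = (\<lambda>h. f 0)"
  by (metis add_0 degree_le.simps(1))

text \<open>By the discrete Leibniz rule the difference of \<open>f * f'\<close> is
  \<open>?d * ?d' + ?d * f' + f * ?d'\<close>, and each product has smaller total degree. Constant
  factors are treated apart, as their degree cannot drop.\<close>

lemma degree_le_mult:
  "degree_le m f \<Longrightarrow> degree_le n f' \<Longrightarrow> degree_le (m + n) (\<lambda>h. f h * f' h)"
proof (induction "m + n" arbitrary: m n f f' rule: less_induct)
  case less
  consider "m = 0" | "n = 0" | m' n' where "m = Suc m'" "n = Suc n'"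
    by (meson not0_implies_Suc)
  then show ?case
  proof cases
    case 1
    then obtain c where "f = (\<lambda>h. c)" using less.prems(1) degree_le_0D by blast
    then show ?thesis using degree_le_cmult[OF less.prems(2), of c] 1 by simp
  next
    case 2
    then obtain c where "f' = (\<lambda>h. c)" using less.prems(2) degree_le_0D by blast
    then show ?thesis
      using degree_le_cmult[OF less.prems(1), of c] 2 by (simp add: mult.commute)
  next
    case 3
    show ?thesis
      unfolding 3 add_Suc degree_le.simps(2)
    proof (intro allI)
      fix g
      let ?d = "\<lambda>h. f (h + g) - f h" and ?d' = "\<lambda>h. f' (h + g) - f' h"
      have d: "degree_le m' ?d" "degree_le n' ?d'"
        using less.prems 3 by auto
      have "degree_le (Suc (m' + n')) (\<lambda>h. ?d h * ?d' h)"
        using d 3 by (intro degree_le_Suc less.hyps) auto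
      moreover have "degree_le (m' + n) (\<lambda>h. ?d h * f' h)"
        using d less.prems 3 by (intro less.hyps) auto
      moreover have "degree_le (m + n') (\<lambda>h. f h * ?d' h)"
        using d less.prems 3 by (intro less.hyps) auto
      ultimately have "degree_le (Suc (m' + n')) (\<lambda>h. ?d h * ?d' h + (?d h * f' h + f h * ?d' h))"
        by (intro degree_le_add) (simp_all add: 3 del: degree_le.simps)
      then show "degree_le (m' + Suc n') (\<lambda>h. f (h + g) * f' (h + g) - f h * f' h)"
        by (simp add: algebra_simps del: degree_le.simps)
    qed
  qed
qed

text \<open>Pairing \<open>J\<close> with \<open>insert i J\<close> turns the sum into minus the
  same sum over the smaller set for the difference of \<open>f\<close> in direction
  \<open>g i\<close>, whose degree is one less.\<close>

lemma alternating_sum_eq_0: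
  fixes f :: "'a::ab_group_add \<Rightarrow> 'b::comm_ring_1"
  assumes "finite I" "degree_le n f" "n < card I"
  shows "(\<Sum>J\<in>Pow I. (-1) ^ card J * f (h + sum g J)) = 0"
  using assms
proof (induction I arbitrary: n f h rule: finite_induct)
  case (insert i I)
  let ?d = "\<lambda>h. f (h + g i) - f h"
  have "(\<Sum>J\<in>Pow (insert i I). (-1) ^ card J * f (h + sum g J)) =
    (\<Sum>J\<in>Pow I. (-1) ^ card J * f (h + sum g J)) +
    (\<Sum>J\<in>insert i ` Pow I. (-1) ^ card J * f (h + sum g J))"
    unfolding Pow_insert using insert.hyps by (intro sum.union_disjoint) auto
  also have "(\<Sum>J\<in>insert i ` Pow I. (-1) ^ card J * f (h + sum g J)) =
    (\<Sum>J\<in>Pow I. (-1) ^ card (insert i J) * f (h + sum g (insert i J)))"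
    using insert.hyps by (intro sum.reindex_cong[where l = "insert i"]) (auto intro!: inj_onI)
  also have "\<dots> = (\<Sum>J\<in>Pow I. - ((-1) ^ card J * f (h + sum g J + g i)))"
  proof (rule sum.cong)
    fix J assume "J \<in> Pow I"
    then have "finite J" "i \<notin> J" using insert.hyps finite_subset by auto
    then show "(-1) ^ card (insert i J) * f (h + sum g (insert i J)) =
      - ((-1) ^ card J * f (h + sum g J + g i))"
      by (simp add: algebra_simps)
  qed simp
  also have "(\<Sum>J\<in>Pow I. (-1) ^ card J * f (h + sum g J)) + \<dots> =
    - (\<Sum>J\<in>Pow I. (-1) ^ card J * ?d (h + sum g J))"
    by (simp add: sum_negf[symmetric] sum.distrib[symmetric] algebra_simps)
  also have "(\<Sum>J\<in>Pow I. (-1) ^ card J * ?d (h + sum g J)) = 0"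
  proof (cases n)
    case 0
    then show ?thesis using insert.prems(1) by simp
  next
    case (Suc n')
    then show ?thesis using insert by (intro insert.IH[of n']) simp_all
  qed
  finally show ?case by simp
qed simp

lemma sum_const_funpow: "(\<Sum>j\<in>J. v) = ((+) v ^^ card J) (0 :: 'a::comm_monoid_add)"
  by (induction J rule: infinite_finite_induct) simp_all

section \<open>Sequences over \<open>C\<^sub>3\<^sup>3\<close>\<close>

lemma C3_cases:
  fixes x :: C3
  obtains "x = 0" | "x = 1" | "x = 2"
proof (cases x rule: bit1_cases)
  case (of_int z)
  then have "z = 0 \<or> z = 1 \<or> z = 2" by auto
  then show ?thesis using that of_int by auto
qed

lemma C3_three_times: "3 * x = (0 :: C3)"
  by (cases x rule: C3_cases) simp_all

lemma C3_cubed_three_times: "x + x + x = (0 :: C3_cubed)"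
  by (cases x) (simp add: C3_three_times zero_prod_def)

text \<open>A coordinate is additive, so its differences are constant and its degree is 1. In
  \<open>C3\<close> every nonzero square is 1.\<close>

lemma degree_le_zero_indicator:
  "degree_le 6 (\<lambda>h :: C3_cubed. if h = 0 then 1 else 0 :: C3)"
proof -
  have square: "degree_le 2 (\<lambda>h. 1 + (- 1) * (p h * p h))"
    if "\<And>g h. p (h + g) = p h + p g" for p :: "C3_cubed \<Rightarrow> C3"
  proof -
    have "degree_le 1 p" using that by (simp add: degree_le_const)
    from degree_le_mult[OF this this] have "degree_le 2 (\<lambda>h. p h * p h)"
      by (simp add: numeral_2_eq_2)
    then show ?thesis by (intro degree_le_add degree_le_cmult degree_le_const)
  qed
  let ?q = "\<lambda>p :: C3_cubed \<Rightarrow> C3. \<lambda>h. 1 + (- 1) * (p h * p h)"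
  have "degree_le (2 + (2 + 2)) (\<lambda>h. ?q fst h * (?q (fst \<circ> snd) h * ?q (snd \<circ> snd) h))"
    by (intro degree_le_mult square) simp_all
  moreover have "?q fst h * (?q (fst \<circ> snd) h * ?q (snd \<circ> snd) h) = (if h = 0 then 1 else 0)" for h
  proof -
    have "1 + (- 1) * (x * x) = (if x = 0 then 1 else 0)" for x :: C3
      by (cases x rule: C3_cases) simp_all
    then show ?thesis by (cases h) (simp add: zero_prod_def)
  qed
  ultimately show ?thesis by simp
qed

text \<open>In the alternating sum the empty set contributes 1. Any other zero-sum set omits exactly
  one index \<open>i\<close>, with \<open>g i = sum g I\<close>, and contributes 1 as its size 6 is
  even.\<close>

lemma sum_of_seven:
  fixes g :: "'i \<Rightarrow> C3_cubed"
  assumes I: "card I = 7"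
    and no_short: "\<And>J. J \<subseteq> I \<Longrightarrow> 1 \<le> card J \<Longrightarrow> card J \<le> 5 \<Longrightarrow> sum g J \<noteq> 0"
    and nonzero: "sum g I \<noteq> 0"
  shows "card {i\<in>I. g i = sum g I} mod 3 = 2"
proof -
  have "finite I" using I card.infinite by fastforce
  let ?A = "{i\<in>I. g i = sum g I}"
  let ?w = "\<lambda>J. (-1) ^ card J * (if sum g J = 0 then 1 else 0) :: C3"
  have zero_sums: "{J\<in>Pow I. sum g J = 0} = insert {} ((\<lambda>i. I - {i}) ` ?A)"
  proof (intro equalityI subsetI)
    fix J assume J: "J \<in> {J\<in>Pow I. sum g J = 0}"
    show "J \<in> insert {} ((\<lambda>i. I - {i}) ` ?A)"
    proof (cases "J = {}")
      case False
      have "finite J" using J \<open>finite I\<close> finite_subset by auto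
      with False have "1 \<le> card J" by (simp add: Suc_le_eq card_gt_0_iff)
      then have "5 < card J" using no_short[of J] J by fastforce
      moreover have "card J \<noteq> 7"
        using J nonzero I card_subset_eq[OF \<open>finite I\<close>, of J] by auto
      moreover have "card J \<le> 7" using J I card_mono[OF \<open>finite I\<close>, of J] by auto
      ultimately have "card (I - J) = 1"
        using J I \<open>finite J\<close> by (simp add: card_Diff_subset)
      then obtain i where i: "I - J = {i}" by (auto simp: card_1_singleton_iff)
      then have "J = I - {i}" "i \<in> I" using J by auto
      moreover have "g i = sum g I"
        using sum.remove[OF \<open>finite I\<close> \<open>i \<in> I\<close>, of g] J calculation by simp
      ultimately show ?thesis by blast
    qed simp
  next
    fix J assume "J \<in> insert {} ((\<lambda>i. I - {i}) ` ?A)"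
    then show "J \<in> {J\<in>Pow I. sum g J = 0}"
      using \<open>finite I\<close> by (auto simp: sum_diff1)
  qed
  have "0 = (\<Sum>J\<in>Pow I. ?w J)"
    using alternating_sum_eq_0[OF \<open>finite I\<close> degree_le_zero_indicator, of 0 g] I by simp
  also have "\<dots> = (\<Sum>J\<in>{J\<in>Pow I. sum g J = 0}. (-1) ^ card J)"
    using \<open>finite I\<close> by (subst sum.inter_filter) (auto intro!: sum.cong)
  also have "\<dots> = 1 + (\<Sum>J\<in>(\<lambda>i. I - {i}) ` ?A. (-1) ^ card J)"
  proof -
    have "{} \<noteq> I - {i}" for i
      using I \<open>finite I\<close> by (metis card.empty card_Diff1_le card_Diff_singleton_if diff_Suc_1
          numeral_eq_Suc pred_numeral_simps(3) zero_neq_numeral Suc_numeral)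
    then show ?thesis unfolding zero_sums using \<open>finite I\<close> by (subst sum.insert) auto
  qed
  also have "(\<Sum>J\<in>(\<lambda>i. I - {i}) ` ?A. (-1) ^ card J) = (\<Sum>i\<in>?A. 1 :: C3)"
    using I by (intro sum.reindex_cong[where l = "\<lambda>i. I - {i}"]) (auto intro!: inj_onI)
  also have "\<dots> = of_nat (card ?A)" by simp
  finally have c: "1 + of_nat (card ?A) = (0 :: C3)" by simp
  have "(of_nat (card ?A) :: C3) = of_nat (3 * (card ?A div 3) + card ?A mod 3)" by simp
  also have "\<dots> = of_nat (card ?A mod 3)" unfolding of_nat_add of_nat_mult by (simp add: C3_three_times)
  finally have "1 + of_nat (card ?A mod 3) = (0 :: C3)" using c by simp
  moreover have "card ?A mod 3 = 0 \<or> card ?A mod 3 = 1 \<or> card ?A mod 3 = 2" by auto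
  ultimately show ?thesis by auto
qed

lemma short_zero_sum_of_nine:
  fixes g :: "'i \<Rightarrow> C3_cubed"
  assumes K: "card K = 9"
  shows "\<exists>J\<subseteq>K. 1 \<le> card J \<and> card J \<le> 5 \<and> sum g J = 0"
proof (rule ccontr)
  assume "\<not> ?thesis"
  then have no_short: "sum g J \<noteq> 0" if "J \<subseteq> K" "1 \<le> card J" "card J \<le> 5" for J
    using that by blast
  have "finite K" using K card.infinite by fastforce
  define fib where "fib v = {k\<in>K. g k = v}" for v
  define s where "s = sum g K"
  define V where "V = g ` K"
  define D where "D = {v. card (fib v) = 2}"
  have fin_fib: "finite (fib v)" for v using \<open>finite K\<close> by (simp add: fib_def)
  have "finite V" using \<open>finite K\<close> by (simp add: V_def)
  \<comment> \<open>Three equal terms would be a zero-sum subsequence of length 3.\<close>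
  have fib_le: "card (fib v) \<le> 2" for v
  proof (rule ccontr)
    assume "\<not> card (fib v) \<le> 2"
    then obtain J where J: "J \<subseteq> fib v" "card J = 3"
      using obtain_subset_with_card_n[of 3 "fib v"] by auto
    then have "sum g J = (\<Sum>j\<in>J. v)" by (intro sum.cong) (auto simp: fib_def)
    also have "\<dots> = v + v + v"
      by (simp add: sum_const_funpow J(2) numeral_eq_Suc add.assoc)
    also have "\<dots> = 0" by (rule C3_cubed_three_times)
    finally show False using no_short[of J] J by (auto simp: fib_def)
  qed
  have fib_pos: "1 \<le> card (fib v)" if "v \<in> V" for v
    using that fin_fib by (auto simp: V_def fib_def Suc_le_eq card_gt_0_iff)
  have "D \<subseteq> V"
  proof
    fix v assume "v \<in> D"
    then have "fib v \<noteq> {}" by (auto simp: D_def)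
    then show "v \<in> V" by (auto simp: fib_def V_def)
  qed
  then have "finite D" using \<open>finite V\<close> finite_subset by blast
  \<comment> \<open>Removing \<open>i\<close> and \<open>j\<close> leaves seven terms with sum
    \<open>s - g i - g j\<close>. If this is nonzero, its multiplicity among them is 2 modulo 3,
    hence exactly 2.\<close>
  have pair: "s - g i - g j \<in> insert 0 D" if "i \<in> K" "j \<in> K" "i \<noteq> j" for i j
  proof (cases "s - g i - g j = 0")
    case False
    let ?I = "K - {i, j}"
    have "card ?I = 7" using that K by (simp add: card_Diff_subset)
    moreover have sum: "sum g ?I = s - g i - g j"
      using that \<open>finite K\<close> sum_diff[of K "{i, j}" g] by (simp add: s_def algebra_simps)
    moreover have "sum g J \<noteq> 0" if "J \<subseteq> ?I" "1 \<le> card J" "card J \<le> 5" for J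
      using that no_short by blast
    ultimately have "card {k\<in>?I. g k = s - g i - g j} mod 3 = 2"
      using sum_of_seven[of ?I g] False by auto
    then have "2 \<le> card {k\<in>?I. g k = s - g i - g j}" by presburger
    also have "\<dots> \<le> card (fib (s - g i - g j))"
      by (intro card_mono fin_fib) (auto simp: fib_def)
    finally show ?thesis using fib_le[of "s - g i - g j"] by (simp add: D_def)
  qed simp
  \<comment> \<open>Applied to the constant 1 this counts the terms; applied to \<open>id\<close> it
    gives \<open>s\<close>.\<close>
  have fibres: "(\<Sum>k\<in>K. f (g k)) = sum f V + sum f D" for f :: "C3_cubed \<Rightarrow> 'c::ab_group_add"
  proof -
    have "(\<Sum>k\<in>K. f (g k)) = (\<Sum>v\<in>V. \<Sum>k\<in>fib v. f (g k))"
      unfolding V_def fib_def by (rule sum.image_gen[OF \<open>finite K\<close>])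
    also have "\<dots> = (\<Sum>v\<in>V. f v + (if v \<in> D then f v else 0))"
    proof (rule sum.cong)
      fix v assume "v \<in> V"
      have "(\<Sum>k\<in>fib v. f (g k)) = (\<Sum>k\<in>fib v. f v)" by (intro sum.cong) (auto simp: fib_def)
      moreover have "card (fib v) = 1 \<or> card (fib v) = 2"
        using fib_le[of v] fib_pos[OF \<open>v \<in> V\<close>] by linarith
      ultimately show "(\<Sum>k\<in>fib v. f (g k)) = f v + (if v \<in> D then f v else 0)"
        by (auto simp: sum_const_funpow D_def numeral_2_eq_2)
    qed simp
    also have "\<dots> = sum f V + sum f D"
      using \<open>finite V\<close> \<open>D \<subseteq> V\<close>
      by (simp add: sum.distrib sum.inter_restrict[symmetric] Int_absorb1)
    finally show ?thesis .
  qed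
  from fibres[of "\<lambda>_. 1 :: int"] have card_VD: "card V + card D = 9"
    using K by simp
  have card_D_le: "card D \<le> card V" by (rule card_mono[OF \<open>finite V\<close> \<open>D \<subseteq> V\<close>])
  have D_shift: "(\<lambda>v. s - a - v) ` V \<subseteq> insert 0 D" if "a \<in> D" for a
  proof
    fix x assume "x \<in> (\<lambda>v. s - a - v) ` V"
    then obtain j where j: "j \<in> K" "x = s - a - g j" by (auto simp: V_def)
    \<comment> \<open>As \<open>a\<close> occurs twice, a copy of it other than \<open>j\<close>
      remains even when \<open>g j = a\<close>.\<close>
    have "\<exists>i\<in>fib a. i \<noteq> j"
      using that unfolding D_def
      by (metis (mono_tags, lifting) card_2_iff' mem_Collect_eq)
    then show "x \<in> insert 0 D" using pair j by (auto simp: fib_def)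
  qed
  have inj: "inj_on (\<lambda>v. s - a - v) V" for a by (auto intro!: inj_onI)
  \<comment> \<open>Otherwise the nine terms are distinct, yet any two of them sum to
    \<open>s\<close>.\<close>
  have "D \<noteq> {}"
  proof
    assume "D = {}"
    then have "card (g ` K) = card K" using card_VD K by (simp add: V_def)
    then have "inj_on g K" using \<open>finite K\<close> eq_card_imp_inj_on by blast
    obtain J where "J \<subseteq> K" "card J = 3" using obtain_subset_with_card_n[of 3 K] K by auto
    then obtain i j k where ijk: "i \<in> K" "j \<in> K" "k \<in> K" "i \<noteq> j" "i \<noteq> k" "j \<noteq> k"
      by (auto simp: card_Suc_eq numeral_3_eq_3)
    then have "s - g i - g j = 0" "s - g i - g k = 0"
      using pair[of i j] pair[of i k] \<open>D = {}\<close> by auto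
    then have "g j = g k" by (metis eq_iff_diff_eq_0)
    then show False using \<open>inj_on g K\<close> ijk by (simp add: inj_on_def)
  qed
  have key: "card D = 4 \<and> a = - s" if a: "a \<in> D" for a
  proof -
    \<comment> \<open>The reflection \<open>v \<mapsto> s - a - v\<close> embeds \<open>V\<close>
      into \<open>insert 0 D\<close>; the count \<open>card V + card D = 9\<close> then leaves only
      the sizes 5 and 4, and the embedding is onto.\<close>
    have "card V \<le> card (insert 0 D)"
      using card_inj_on_le[OF inj D_shift[OF a]] \<open>finite D\<close> by simp
    then have le: "card V \<le> Suc (card D)" using card_insert_le_m1 \<open>finite D\<close>
      by (metis card_insert_if le_SucI le_trans order_refl)
    then have 4: "card D = 4" "card V = 5" using card_VD card_D_le by linarith+
    have "card (insert 0 D) \<le> card V"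
      using 4 \<open>finite D\<close> by (simp add: card_insert_if)
    then have eq: "(\<lambda>v. s - a - v) ` V = insert 0 D"
      using \<open>finite D\<close> D_shift[OF a] by (intro card_seteq) (auto simp: card_image inj)
    \<comment> \<open>Summing over both sides of \<open>eq\<close> gives
      \<open>sum id D = 5 (s - a) - sum id V\<close>. Modulo 3 this reads
      \<open>s = 2 (s - a)\<close>, so \<open>a = - s\<close>.\<close>
    have "sum id D = sum id (insert 0 D)" 
      using \<open>finite D\<close> by (cases "0 \<in> D") (simp_all add: insert_absorb)
    also have "\<dots> = (\<Sum>v\<in>V. s - a - v)" unfolding eq[symmetric] by (simp add: sum.reindex inj)
    also have "\<dots> = (\<Sum>v\<in>V. s - a) - sum id V" by (simp add: sum_subtractf)
    also have "(\<Sum>v\<in>V. s - a) = (s - a) + (s - a) + (s - a) + ((s - a) + (s - a))"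
      unfolding sum_const_funpow 4(2)
      by (simp add: numeral_eq_Suc add.assoc del: add_diff_eq diff_add_eq)
    also have "\<dots> = (s - a) + (s - a)" using C3_cubed_three_times by simp
    finally have "sum id V + sum id D = (s - a) + (s - a)" by simp
    moreover have "s = sum id V + sum id D" using fibres[of id] by (simp add: s_def)
    ultimately have "s = a + a" by (simp add: algebra_simps)
    then have "a + s = 0" using C3_cubed_three_times[of a] by (simp add: add.assoc)
    with 4 show ?thesis by (simp add: eq_neg_iff_add_eq_0)
  qed
  then have "D \<subseteq> {- s}" by blast
  then have "card D \<le> 1" using card_mono[of "{- s}" D] by simp
  then show False using key \<open>D \<noteq> {}\<close> by auto
qed

lemma short_zero_sum_mset:
  fixes S :: "C3_cubed multiset"
  assumes "size S = 9"
  shows "\<exists>T. T \<subseteq># S \<and> zero_sum T \<and> 1 \<le> size T \<and> size T \<le> 5"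
proof -
  obtain xs where xs: "mset xs = S" using ex_mset by blast
  have "card {..<length xs} = 9" using assms xs by auto
  from short_zero_sum_of_nine[OF this, of "(!) xs"]
  obtain J where J: "J \<subseteq> {..<length xs}" "1 \<le> card J" "card J \<le> 5" "sum ((!) xs) J = 0" by blast
  let ?T = "image_mset ((!) xs) (mset_set J)"
  have "?T \<subseteq># image_mset ((!) xs) (mset_set {..<length xs})"
    using J(1) by (intro image_mset_subseteq_mono subset_imp_msubset_mset_set) simp_all
  also have "\<dots> = S"
    using xs by (metis map_nth mset_map mset_upt lessThan_atLeast0)
  finally have "?T \<subseteq># S" .
  moreover have "zero_sum ?T" using J(4) by (simp add: zero_sum_def sum_unfold_sum_mset)
  ultimately show ?thesis using J by (intro exI[of _ ?T]) simp
qed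

section \<open>Extremal sequence of length eight: a doubled cap in an affine plane\<close>

definition doubled_cap :: "C3_cubed multiset" where
  "doubled_cap = {#(0, 0, 1), (0, 0, 1), (0, 1, 1), (0, 1, 1),
    (1, 0, 1), (1, 0, 1), (1, 1, 1), (1, 1, 1)#}"

lemma set_doubled_cap:
  "set_mset doubled_cap = {(0, 0, 1), (0, 1, 1), (1, 0, 1), (1, 1, 1)}"
  by (auto simp: doubled_cap_def)

lemma doubled_cap_no_short_zero_sum:
  assumes T: "T \<subseteq># doubled_cap" and "zero_sum T"
  shows "\<not> (1 \<le> size T \<and> size T \<le> 5)"
proof
  assume size: "1 \<le> size T \<and> size T \<le> 5"
  have "snd (snd (sum_mset T)) = of_nat (size T)" if "set_mset T \<subseteq> set_mset doubled_cap" for T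
    using that by (induction T) (auto simp: set_doubled_cap)
  then have "of_nat (size T) = (0 :: C3)"
    using T \<open>zero_sum T\<close> by (metis set_mset_mono zero_sum_def snd_zero)
  moreover have "size T = 1 \<or> size T = 2 \<or> size T = 3 \<or> size T = 4 \<or> size T = 5"
    using size by auto
  ultimately have "size T = 3" by auto
  moreover obtain xs where "mset xs = T" using ex_mset by blast
  ultimately obtain a b c where abc: "T = {#a, b, c#}"
    by (auto simp: numeral_3_eq_3 length_Suc_conv)
  then have "a \<in># doubled_cap" "b \<in># doubled_cap" "c \<in># doubled_cap"
    using T mset_subset_eqD by fastforce+
  moreover have "a + b + c = 0" using \<open>zero_sum T\<close> abc by (simp add: zero_sum_def add.assoc)
  \<comment> \<open>Three entries from 0 and 1 sum to 0 modulo 3 only if they are equal; this is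
    applied to each of the first two coordinates.\<close>
  ultimately have "a = b \<and> b = c" by (auto simp: set_doubled_cap zero_prod_def)
  moreover have "count doubled_cap a \<le> 2" by (auto simp: doubled_cap_def)
  ultimately show False using mset_subset_eq_count[OF T, of a] abc by simp
qed

theorem theorem1p8: "s_le TYPE(C3_cubed) 5 = 9"
proof -
  let ?L = "{l. \<forall>S :: C3_cubed multiset. size S = l \<longrightarrow>
     (\<exists>T. T \<subseteq># S \<and> zero_sum T \<and> 1 \<le> size T \<and> size T \<le> 5)}"
  have "9 \<in> ?L" using short_zero_sum_mset by blast
  moreover have "9 \<le> l" if l: "l \<in> ?L" for l
  proof (rule ccontr)
    assume "\<not> 9 \<le> l"
    \<comment> \<open>All lengths up to 8 must be ruled out, so a part of \<open>doubled_cap\<close>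
      of size \<open>l\<close> serves as the counterexample.\<close>
    then have "l \<le> size doubled_cap" by (simp add: doubled_cap_def)
    moreover obtain xs where xs: "mset xs = doubled_cap" using ex_mset by blast
    moreover have "mset (take l xs) \<subseteq># mset xs"
      by (metis append_take_drop_id mset_append mset_subset_eq_add_left)
    ultimately obtain S where S: "S \<subseteq># doubled_cap" "size S = l"
      by (metis length_take min.absorb2 size_mset)
    then obtain T where "T \<subseteq># S" "zero_sum T" "1 \<le> size T \<and> size T \<le> 5"
      using l by auto
    then show False using S doubled_cap_no_short_zero_sum subset_mset.order_trans by blast
  qed
  ultimately have "Inf (enat ` ?L) = enat 9"
    by (intro antisym Inf_lower Inf_greatest imageI) auto
  then show ?thesis by (simp add: s_le_def numeral_eq_enat)
qed

end
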